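(* For objects $\gamma,\alpha,\beta$ and a variable $x$, the formula $\big(\{x\mid\gamma\}\sqsubseteq\{x\mid\alpha\Rightarrow\beta\}\big)\Rightarrow\big(V\sqsubseteq\{x\mid\gamma\}\Rightarrow\{x\mid\alpha\}\sqsubseteq\{x\mid\beta\}\big)$ is derivable.
   Context: Formal system. Objects are generated from the constant $\varnothing$ by: $(\alpha)^{\mathsf c}$, $(\alpha)^{\mathsf v}$ (variables are objects of this form), $(\alpha\,\&\,\beta)$ (federation), $(\alpha\Rightarrow\beta)$ (containment/implication), $(\alpha\cap\beta)$, and classes $\{x\mid\beta\}$ ($x$ a variable, which becomes a bound index). $\alpha[x:=\beta]$ replaces every free appearance of $x$ by $\beta$. Abbreviations: $\bot:=\varnothing^{\mathsf c}$; $\neg a:=(a\Rightarrow\bot)$; $\bar a:=(\varnothing\Rightarrow a)$; $a\vee b:=\overline{\bar a\cap\bar b}$; $a=b:=(a\Rightarrow b)\&(b\Rightarrow a)$; $a\neq b:=\neg(a=b)$; $a\sqsubseteq b:=(b\Rightarrow a)$ (binding more tightly than $\Rightarrow$); $\mathrm{Sing}(a):=(\bar a\neq a)\,\&\,((a\Rightarrow b)\Rightarrow(\bar b\vee a=b))$, with $b$ a variable; $a\in b:=\mathrm{Sing}(a)\&(b\Rightarrow a)$; $V:=\{x\mid\varnothing\}$. Rules: R1 from $\alpha$ and $\alpha\Rightarrow\beta$ infer $\beta$; R2 from $\alpha$ infer $\alpha[x:=\beta]$; R3 if $x$ does not appear in $\gamma$, from $\gamma\Rightarrow(\alpha\Rightarrow\beta)$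 infer $\gamma\Rightarrow(\{x\mid\beta\}\Rightarrow\{x\mid\alpha\})$. Axioms ($a,b,c,d,x$ variables): A1 $((c\Rightarrow a)\&(c\Rightarrow(a\Rightarrow b)))\Rightarrow(c\Rightarrow b)$; A2 $((d\Rightarrow(a\Rightarrow b))\&(d\Rightarrow(b\Rightarrow c)))\Rightarrow(d\Rightarrow(a\Rightarrow c))$; A3 $((c\Rightarrow a)\&(c\Rightarrow b))\Rightarrow(c\Rightarrow(a\&b))$; A4 $(a\&b)\Rightarrow a$, $(a\&b)\Rightarrow b$; A5 $a\Rightarrow(a\cap b)$, $b\Rightarrow(a\cap b)$; A6 $((a\Rightarrow c)\&(b\Rightarrow c))\Rightarrow((a\cap b)\Rightarrow c)$; A7 $a\Rightarrow a$; A8 $a\Rightarrow\varnothing$; A9 $\bot\Rightarrow a$; A10 $(\varnothing\Rightarrow a)\Rightarrow((\varnothing\Rightarrow b)\Rightarrow(a\&b))$; A11 $(a\Rightarrow b)\Rightarrow(\varnothing\Rightarrow(a\Rightarrow b))$; A12 $(((a\Rightarrow b)\Rightarrow\bot)\Rightarrow\bot)\Rightarrow(a\Rightarrow b)$; A13 (schema) $a\in\{x\mid\alpha\}=(\mathrm{Sing}(a)\&\alpha[x:=a])$; A14a $a\Rightarrow\{x\mid x\in a\}$; A14b $(V\Rightarrow a)\Rightarrow(\{x\mid x\in a\}\Rightarrow a)$. *)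

theory Defs
  imports Main
begin

text \<open>
  Syntax with class-bound variables turned into de Bruijn indices. \<open>Bnd\<close> exists only to represent
  such indices; the objects of the system are singled out by \<open>is_object\<close> below.  The argument of
  \<open>Var\<close> is a label: variables are atomic, so nothing appears inside them and substitution leaves
  the label alone.
\<close>

datatype obj =
    Empty  ("\<^bold>\<emptyset>")
  | Cst obj
  | Var obj
  | Bnd nat
  | Fed obj obj  (infixr "\<^bold>&" 65)
  | Imp obj obj  (infixr "\<^bold>\<Rightarrow>" 55)
  | Cap obj obj  (infixr "\<^bold>\<inter>" 70)
  | Cls obj

text \<open>\<open>close k x t\<close> turns every free appearance of \<open>x\<close> in \<open>t\<close> into the index that points to the
  class \<open>k\<close> levels above.\<close>

primrec close :: "nat \<Rightarrow> obj \<Rightarrow> obj \<Rightarrow> obj" where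
  "close k x \<^bold>\<emptyset> = \<^bold>\<emptyset>"
| "close k x (Cst t) = Cst (close k x t)"
| "close k x (Var n) = (if Var n = x then Bnd k else Var n)"
| "close k x (Bnd i) = Bnd i"
| "close k x (s \<^bold>& t) = (close k x s \<^bold>& close k x t)"
| "close k x (s \<^bold>\<Rightarrow> t) = (close k x s \<^bold>\<Rightarrow> close k x t)"
| "close k x (s \<^bold>\<inter> t) = (close k x s \<^bold>\<inter> close k x t)"
| "close k x (Cls t) = Cls (close (Suc k) x t)"

definition cls :: "obj \<Rightarrow> obj \<Rightarrow> obj"  ("\<lbrace>_ \<^bold>| _\<rbrace>") where
  "\<lbrace>x \<^bold>| \<beta>\<rbrace> = Cls (close 0 x \<beta>)"

inductive is_object :: "obj \<Rightarrow> bool" where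
  "is_object \<^bold>\<emptyset>"
| "is_object \<alpha> \<Longrightarrow> is_object (Cst \<alpha>)"
| "is_object \<alpha> \<Longrightarrow> is_object (Var \<alpha>)"
| "is_object \<alpha> \<Longrightarrow> is_object \<beta> \<Longrightarrow> is_object (\<alpha> \<^bold>& \<beta>)"
| "is_object \<alpha> \<Longrightarrow> is_object \<beta> \<Longrightarrow> is_object (\<alpha> \<^bold>\<Rightarrow> \<beta>)"
| "is_object \<alpha> \<Longrightarrow> is_object \<beta> \<Longrightarrow> is_object (\<alpha> \<^bold>\<inter> \<beta>)"
| "is_object \<nu> \<Longrightarrow> is_object \<beta> \<Longrightarrow> is_object \<lbrace>Var \<nu> \<^bold>| \<beta>\<rbrace>"

definition is_variable :: "obj \<Rightarrow> bool" where
  "is_variable x \<longleftrightarrow> (\<exists>\<nu>. is_object \<nu> \<and> x = Var \<nu>)"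

definition distinct_variables :: "obj list \<Rightarrow> bool" where
  "distinct_variables xs \<longleftrightarrow> distinct xs \<and> (\<forall>x\<in>set xs. is_variable x)"

text \<open>\<open>subst t x u\<close> is \<open>t[x:=u]\<close>.  It is only used with \<open>u\<close> an object; objects have no dangling
  indices, so no capture can occur under \<open>Cls\<close>.\<close>

primrec subst :: "obj \<Rightarrow> obj \<Rightarrow> obj \<Rightarrow> obj" where
  "subst \<^bold>\<emptyset> x u = \<^bold>\<emptyset>"
| "subst (Cst t) x u = Cst (subst t x u)"
| "subst (Var n) x u = (if Var n = x then u else Var n)"
| "subst (Bnd i) x u = Bnd i"
| "subst (s \<^bold>& t) x u = (subst s x u \<^bold>& subst t x u)"
| "subst (s \<^bold>\<Rightarrow> t) x u = (subst s x u \<^bold>\<Rightarrow> subst t x u)"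
| "subst (s \<^bold>\<inter> t) x u = (subst s x u \<^bold>\<inter> subst t x u)"
| "subst (Cls t) x u = Cls (subst t x u)"

text \<open>The variables appearing in an object (a bound index is not an appearance).\<close>

primrec fvs :: "obj \<Rightarrow> obj set" where
  "fvs \<^bold>\<emptyset> = {}"
| "fvs (Cst t) = fvs t"
| "fvs (Var n) = {Var n}"
| "fvs (Bnd i) = {}"
| "fvs (s \<^bold>& t) = fvs s \<union> fvs t"
| "fvs (s \<^bold>\<Rightarrow> t) = fvs s \<union> fvs t"
| "fvs (s \<^bold>\<inter> t) = fvs s \<union> fvs t"
| "fvs (Cls t) = fvs t"

definition bottom :: obj  ("\<^bold>\<bottom>") where
  "\<^bold>\<bottom> = Cst \<^bold>\<emptyset>"

definition neg :: "obj \<Rightarrow> obj"  ("\<^bold>\<not> _" [80] 80) where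
  "\<^bold>\<not> a = (a \<^bold>\<Rightarrow> \<^bold>\<bottom>)"

definition bar :: "obj \<Rightarrow> obj" where
  "bar a = (\<^bold>\<emptyset> \<^bold>\<Rightarrow> a)"

definition disj :: "obj \<Rightarrow> obj \<Rightarrow> obj"  (infixr "\<^bold>\<or>" 63) where
  "a \<^bold>\<or> b = bar (bar a \<^bold>\<inter> bar b)"

definition equal :: "obj \<Rightarrow> obj \<Rightarrow> obj"  (infix "\<^bold>=" 60) where
  "(a \<^bold>= b) = ((a \<^bold>\<Rightarrow> b) \<^bold>& (b \<^bold>\<Rightarrow> a))"

definition unequal :: "obj \<Rightarrow> obj \<Rightarrow> obj"  (infix "\<^bold>\<noteq>" 60) where
  "(a \<^bold>\<noteq> b) = \<^bold>\<not> (a \<^bold>= b)"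

definition below :: "obj \<Rightarrow> obj \<Rightarrow> obj"  (infix "\<^bold>\<sqsubseteq>" 60) where
  "(a \<^bold>\<sqsubseteq> b) = (b \<^bold>\<Rightarrow> a)"

text \<open>The defining formula of \<open>Sing\<close> contains an auxiliary free variable \<open>b\<close>, which is not bound
  by anything and is open to substitution.  It is carried along as the first argument of \<open>Sing\<close>
  and \<open>mem\<close>, so that \<open>mem b a c\<close> is \<open>a \<in> c\<close>.\<close>

definition Sing :: "obj \<Rightarrow> obj \<Rightarrow> obj" where
  "Sing b a = ((bar a \<^bold>\<noteq> a) \<^bold>& ((a \<^bold>\<Rightarrow> b) \<^bold>\<Rightarrow> (bar b \<^bold>\<or> (a \<^bold>= b))))"

definition mem :: "obj \<Rightarrow> obj \<Rightarrow> obj \<Rightarrow> obj" where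
  "mem b a c = (Sing b a \<^bold>& (c \<^bold>\<Rightarrow> a))"

text \<open>The class of all \<open>x\<close> with \<open>\<emptyset>\<close>; the choice of the bound variable is immaterial.\<close>

definition univ :: obj  ("\<^bold>V") where
  "\<^bold>V = \<lbrace>Var \<^bold>\<emptyset> \<^bold>| \<^bold>\<emptyset>\<rbrace>"

lemma univ_eq: "\<lbrace>x \<^bold>| \<^bold>\<emptyset>\<rbrace> = \<^bold>V"
  by (simp add: univ_def cls_def)

text \<open>Each axiom is a formula in variables, not a schema over objects (except for \<open>\<alpha>\<close> in A13);
  other instances come from R2.  For the same reason it makes no difference to the set of
  derivable objects which pairwise distinct variables are used.\<close>

inductive derivable :: "obj \<Rightarrow> bool"  ("\<turnstile> _" [50] 50) where
  R1: "\<turnstile> \<alpha> \<Longrightarrow> \<turnstile> \<alpha> \<^bold>\<Rightarrow> \<beta> \<Longrightarrow> \<turnstile> \<beta>"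
| R2: "\<turnstile> \<alpha> \<Longrightarrow> is_variable x \<Longrightarrow> is_object \<beta> \<Longrightarrow> \<turnstile> subst \<alpha> x \<beta>"
| R3: "\<turnstile> \<gamma> \<^bold>\<Rightarrow> (\<alpha> \<^bold>\<Rightarrow> \<beta>) \<Longrightarrow> is_variable x \<Longrightarrow> x \<notin> fvs \<gamma> \<Longrightarrow>
       \<turnstile> \<gamma> \<^bold>\<Rightarrow> (\<lbrace>x \<^bold>| \<beta>\<rbrace> \<^bold>\<Rightarrow> \<lbrace>x \<^bold>| \<alpha>\<rbrace>)"
| A1: "distinct_variables [a, b, c] \<Longrightarrow>
       \<turnstile> ((c \<^bold>\<Rightarrow> a) \<^bold>& (c \<^bold>\<Rightarrow> (a \<^bold>\<Rightarrow> b))) \<^bold>\<Rightarrow> (c \<^bold>\<Rightarrow> b)"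
| A2: "distinct_variables [a, b, c, d] \<Longrightarrow>
       \<turnstile> ((d \<^bold>\<Rightarrow> (a \<^bold>\<Rightarrow> b)) \<^bold>& (d \<^bold>\<Rightarrow> (b \<^bold>\<Rightarrow> c))) \<^bold>\<Rightarrow> (d \<^bold>\<Rightarrow> (a \<^bold>\<Rightarrow> c))"
| A3: "distinct_variables [a, b, c] \<Longrightarrow>
       \<turnstile> ((c \<^bold>\<Rightarrow> a) \<^bold>& (c \<^bold>\<Rightarrow> b)) \<^bold>\<Rightarrow> (c \<^bold>\<Rightarrow> (a \<^bold>& b))"
| A4l: "distinct_variables [a, b] \<Longrightarrow> \<turnstile> (a \<^bold>& b) \<^bold>\<Rightarrow> a"
| A4r: "distinct_variables [a, b] \<Longrightarrow> \<turnstile> (a \<^bold>& b) \<^bold>\<Rightarrow> b"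
| A5l: "distinct_variables [a, b] \<Longrightarrow> \<turnstile> a \<^bold>\<Rightarrow> (a \<^bold>\<inter> b)"
| A5r: "distinct_variables [a, b] \<Longrightarrow> \<turnstile> b \<^bold>\<Rightarrow> (a \<^bold>\<inter> b)"
| A6: "distinct_variables [a, b, c] \<Longrightarrow>
       \<turnstile> ((a \<^bold>\<Rightarrow> c) \<^bold>& (b \<^bold>\<Rightarrow> c)) \<^bold>\<Rightarrow> ((a \<^bold>\<inter> b) \<^bold>\<Rightarrow> c)"
| A7: "is_variable a \<Longrightarrow> \<turnstile> a \<^bold>\<Rightarrow> a"
| A8: "is_variable a \<Longrightarrow> \<turnstile> a \<^bold>\<Rightarrow> \<^bold>\<emptyset>"
| A9: "is_variable a \<Longrightarrow> \<turnstile> \<^bold>\<bottom> \<^bold>\<Rightarrow> a"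
| A10: "distinct_variables [a, b] \<Longrightarrow>
       \<turnstile> (\<^bold>\<emptyset> \<^bold>\<Rightarrow> a) \<^bold>\<Rightarrow> ((\<^bold>\<emptyset> \<^bold>\<Rightarrow> b) \<^bold>\<Rightarrow> (a \<^bold>& b))"
| A11: "distinct_variables [a, b] \<Longrightarrow> \<turnstile> (a \<^bold>\<Rightarrow> b) \<^bold>\<Rightarrow> (\<^bold>\<emptyset> \<^bold>\<Rightarrow> (a \<^bold>\<Rightarrow> b))"
| A12: "distinct_variables [a, b] \<Longrightarrow>
       \<turnstile> (((a \<^bold>\<Rightarrow> b) \<^bold>\<Rightarrow> \<^bold>\<bottom>) \<^bold>\<Rightarrow> \<^bold>\<bottom>) \<^bold>\<Rightarrow> (a \<^bold>\<Rightarrow> b)"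
| A13: "distinct_variables [a, b, x] \<Longrightarrow> is_object \<alpha> \<Longrightarrow>
       \<turnstile> mem b a \<lbrace>x \<^bold>| \<alpha>\<rbrace> \<^bold>= (Sing b a \<^bold>& subst \<alpha> x a)"
| A14a: "distinct_variables [a, b, x] \<Longrightarrow> \<turnstile> a \<^bold>\<Rightarrow> \<lbrace>x \<^bold>| mem b x a\<rbrace>"
| A14b: "distinct_variables [a, b, x] \<Longrightarrow>
       \<turnstile> (\<^bold>V \<^bold>\<Rightarrow> a) \<^bold>\<Rightarrow> (\<lbrace>x \<^bold>| mem b x a\<rbrace> \<^bold>\<Rightarrow> a)"

end

theory Submission
  imports Defs
begin

text \<open>
  An implication \<open>p\<close> as hypothesis satisfies \<open>p \<Rightarrow> (\<emptyset> \<Rightarrow> p)\<close>, so a restricted deduction theorem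
  holds: from \<open>p & q \<Rightarrow> r\<close> infer \<open>p \<Rightarrow> (q \<Rightarrow> r)\<close>.  The two inclusions in the theorem compose to the
  implication \<open>p\<close> saying that \<open>V \<sqsubseteq> {x | \<alpha> \<Rightarrow> \<beta>}\<close>.  Under \<open>p\<close> and \<open>x \<in> {x | \<alpha>}\<close>, A13 yields \<open>Sing x\<close>,
  hence \<open>x \<in> V\<close>, hence \<open>x \<in> {x | \<alpha> \<Rightarrow> \<beta>}\<close>, hence \<open>\<beta>\<close>, and so \<open>x \<in> {x | \<beta>}\<close>.  Now R3 compares the
  classes \<open>{x | x \<in> {x | \<alpha>}}\<close> and \<open>{x | x \<in> {x | \<beta>}}\<close>, which A14 identifies with \<open>{x | \<alpha>}\<close> and
  \<open>{x | \<beta>}\<close>.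
\<close>

section \<open>Substitution, closing and appearing variables\<close>

lemma finite_fvs [simp]: "finite (fvs t)"
  by (induction t) auto

lemma subst_idle [simp]: "x \<notin> fvs t \<Longrightarrow> subst t x u = t"
  by (induction t) auto

lemma close_idle [simp]: "x \<notin> fvs t \<Longrightarrow> close k x t = t"
  by (induction t arbitrary: k) auto

lemma fvs_close [simp]: "is_variable x \<Longrightarrow> fvs (close k x t) = fvs t - {x}"
  by (induction t arbitrary: k) (auto simp: is_variable_def)

lemma fvs_cls [simp]: "is_variable x \<Longrightarrow> fvs \<lbrace>x \<^bold>| t\<rbrace> = fvs t - {x}"
  by (simp add: cls_def)

lemma fvs_univ [simp]: "fvs \<^bold>V = {}"
  by (simp add: univ_def cls_def)

lemma subst_variable [simp]: "is_variable y \<Longrightarrow> subst y x u = (if y = x then u else y)"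
  by (auto simp: is_variable_def)

lemma close_variable [simp]: "is_variable y \<Longrightarrow> close k x y = (if y = x then Bnd k else y)"
  by (auto simp: is_variable_def)

text \<open>Since \<open>a\<close> is fresh, every \<open>a\<close> in \<open>subst t x a\<close>
  marks a former \<open>x\<close>. This undoes the renaming in A13.\<close>

lemma subst_subst_back:
  "is_variable a \<Longrightarrow> a \<notin> fvs t \<Longrightarrow> subst (subst t x a) a x = t"
  by (induction t) auto

lemma is_object_variable [simp]: "is_variable x \<Longrightarrow> is_object x"
  by (auto simp: is_variable_def intro: is_object.intros)

lemma is_object_cls [simp]: "is_variable x \<Longrightarrow> is_object t \<Longrightarrow> is_object \<lbrace>x \<^bold>| t\<rbrace>"
  by (auto simp: is_variable_def intro: is_object.intros)

lemma is_object_simps [simp]: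
  "is_object \<^bold>\<emptyset>" "is_object \<^bold>\<bottom>" "is_object \<^bold>V"
  "is_object s \<Longrightarrow> is_object t \<Longrightarrow> is_object (s \<^bold>& t)"
  "is_object s \<Longrightarrow> is_object t \<Longrightarrow> is_object (s \<^bold>\<Rightarrow> t)"
  "is_object s \<Longrightarrow> is_object t \<Longrightarrow> is_object (s \<^bold>\<inter> t)"
  by (auto simp: bottom_def univ_def intro: is_object.intros)

lemma is_object_Sing [simp]: "is_object b \<Longrightarrow> is_object a \<Longrightarrow> is_object (Sing b a)"
  by (simp add: Sing_def bar_def unequal_def neg_def equal_def disj_def)

lemma is_object_mem [simp]:
  "is_object b \<Longrightarrow> is_object a \<Longrightarrow> is_object c \<Longrightarrow> is_object (mem b a c)"
  by (simp add: mem_def)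

lemma subst_bottom [simp]: "subst \<^bold>\<bottom> x u = \<^bold>\<bottom>"
  by (simp add: bottom_def)

lemma subst_Sing [simp]: "subst (Sing b a) x u = Sing (subst b x u) (subst a x u)"
  by (simp add: Sing_def bar_def unequal_def neg_def equal_def disj_def)

lemma subst_mem [simp]: "subst (mem b a c) x u = mem (subst b x u) (subst a x u) (subst c x u)"
  by (simp add: mem_def)

lemma close_mem [simp]: "close k x (mem b a c) = mem (close k x b) (close k x a) (close k x c)"
  by (simp add: mem_def Sing_def bar_def unequal_def neg_def equal_def disj_def bottom_def)

section \<open>Supply of fresh variables\<close>

lemma ex_fresh_variable:
  assumes "finite X"
  obtains a where "is_variable a" "a \<notin> X"
proof -
  define f where "f n = Var ((Cst ^^ n) \<^bold>\<emptyset>)" for n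
  have obj: "is_object ((Cst ^^ n) \<^bold>\<emptyset>)" for n
    by (induction n) (auto intro: is_object.intros)
  \<comment> \<open>The size recovers \<open>n\<close> from the label, so the variables
    \<open>f n\<close> are pairwise distinct.\<close>
  have "size ((Cst ^^ n) \<^bold>\<emptyset>) = n" for n
    by (induction n) auto
  then have "inj f"
    by (metis f_def injI obj.inject(2))
  then have "\<not> range f \<subseteq> X"
    using assms finite_subset finite_imageD infinite_UNIV_nat by blast
  then show thesis
    using that obj by (auto simp: f_def is_variable_def)
qed

lemma ex_fresh_variables:
  assumes "finite X"
  obtains a b c d where "distinct_variables [a, b, c, d]" "a \<notin> X" "b \<notin> X" "c \<notin> X" "d \<notin> X"
proof -
  obtain a where a: "is_variable a" "a \<notin> X"
    using ex_fresh_variable assms by blast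
  obtain b where b: "is_variable b" "b \<notin> insert a X"
    using ex_fresh_variable assms by (metis finite_insert)
  obtain c where c: "is_variable c" "c \<notin> insert a (insert b X)"
    using ex_fresh_variable assms by (metis finite_insert)
  obtain d where d: "is_variable d" "d \<notin> insert a (insert b (insert c X))"
    using ex_fresh_variable assms by (metis finite_insert)
  show thesis
    using that[of a b c d] a b c d by (auto simp: distinct_variables_def)
qed

section \<open>Instances of the axioms at arbitrary objects\<close>

context
  fixes A B C D :: obj
  assumes obj [simp]: "is_object A" "is_object B" "is_object C" "is_object D"
begin

lemma axiom_instances:
  shows "\<turnstile> ((C \<^bold>\<Rightarrow> A) \<^bold>& (C \<^bold>\<Rightarrow> (A \<^bold>\<Rightarrow> B))) \<^bold>\<Rightarrow> (C \<^bold>\<Rightarrow> B)" (is ?A1)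
    and "\<turnstile> ((D \<^bold>\<Rightarrow> (A \<^bold>\<Rightarrow> B)) \<^bold>& (D \<^bold>\<Rightarrow> (B \<^bold>\<Rightarrow> C))) \<^bold>\<Rightarrow> (D \<^bold>\<Rightarrow> (A \<^bold>\<Rightarrow> C))" (is ?A2)
    and "\<turnstile> ((C \<^bold>\<Rightarrow> A) \<^bold>& (C \<^bold>\<Rightarrow> B)) \<^bold>\<Rightarrow> (C \<^bold>\<Rightarrow> (A \<^bold>& B))" (is ?A3)
    and "\<turnstile> (A \<^bold>& B) \<^bold>\<Rightarrow> A" (is ?A4l)
    and "\<turnstile> (A \<^bold>& B) \<^bold>\<Rightarrow> B" (is ?A4r)
    and "\<turnstile> A \<^bold>\<Rightarrow> A" (is ?A7)
    and "\<turnstile> A \<^bold>\<Rightarrow> \<^bold>\<emptyset>" (is ?A8)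
    and "\<turnstile> (\<^bold>\<emptyset> \<^bold>\<Rightarrow> A) \<^bold>\<Rightarrow> ((\<^bold>\<emptyset> \<^bold>\<Rightarrow> B) \<^bold>\<Rightarrow> (A \<^bold>& B))" (is ?A10)
    and "\<turnstile> (A \<^bold>\<Rightarrow> B) \<^bold>\<Rightarrow> (\<^bold>\<emptyset> \<^bold>\<Rightarrow> (A \<^bold>\<Rightarrow> B))" (is ?A11)
proof -
  obtain a b c d where dist: "distinct_variables [a, b, c, d]"
    and fresh [simp]: "a \<notin> fvs A \<union> fvs B \<union> fvs C \<union> fvs D" "b \<notin> fvs A \<union> fvs B \<union> fvs C \<union> fvs D"
      "c \<notin> fvs A \<union> fvs B \<union> fvs C \<union> fvs D" "d \<notin> fvs A \<union> fvs B \<union> fvs C \<union> fvs D"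
    by (rule ex_fresh_variables[of "fvs A \<union> fvs B \<union> fvs C \<union> fvs D"])
      (rule finite_UnI finite_fvs | assumption)+
  have var [simp]: "is_variable a" "is_variable b" "is_variable c" "is_variable d"
    and neq [simp]: "a \<noteq> b" "a \<noteq> c" "a \<noteq> d" "b \<noteq> a" "b \<noteq> c" "b \<noteq> d"
      "c \<noteq> a" "c \<noteq> b" "c \<noteq> d" "d \<noteq> a" "d \<noteq> b" "d \<noteq> c"
    and dists: "distinct_variables [a, b]" "distinct_variables [a, b, c]"
    using dist by (auto simp: distinct_variables_def)
  \<comment> \<open>Four successive uses of R2 act as one simultaneous substitution, because no
    inserted object contains a variable that is replaced later.\<close>
  note inst = R2[OF R2[OF R2[OF R2[OF _ var(1) obj(1)] var(2) obj(2)] var(3) obj(3)] var(4) obj(4)]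
  show ?A1 using inst[OF A1[OF dists(2)]] fresh by simp
  show ?A2 using inst[OF A2[OF dist]] fresh by simp
  show ?A3 using inst[OF A3[OF dists(2)]] fresh by simp
  show ?A4l using inst[OF A4l[OF dists(1)]] fresh by simp
  show ?A4r using inst[OF A4r[OF dists(1)]] fresh by simp
  show ?A7 using inst[OF A7[OF var(1)]] fresh by simp
  show ?A8 using inst[OF A8[OF var(1)]] fresh by simp
  show ?A10 using inst[OF A10[OF dists(1)]] fresh by simp
  show ?A11 using inst[OF A11[OF dists(1)]] fresh by simp
qed

end

text \<open>Objects that do not occur in an instance are set to \<open>Empty\<close>, which
  discharges their assumptions.\<close>

lemmas A1_inst = axiom_instances(1)[OF _ _ _ is_object_simps(1)]
lemmas A2_inst = axiom_instances(2)
lemmas A3_inst = axiom_instances(3)[OF _ _ _ is_object_simps(1)]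
lemmas fed_left = axiom_instances(4)[OF _ _ is_object_simps(1) is_object_simps(1)]
lemmas fed_right = axiom_instances(5)[OF _ _ is_object_simps(1) is_object_simps(1)]
lemmas imp_refl = axiom_instances(6)[OF _ is_object_simps(1) is_object_simps(1) is_object_simps(1)]
lemmas imp_Empty = axiom_instances(7)[OF _ is_object_simps(1) is_object_simps(1) is_object_simps(1)]
lemmas A10_inst = axiom_instances(8)[OF _ _ is_object_simps(1) is_object_simps(1)]
lemmas A11_inst = axiom_instances(9)[OF _ _ is_object_simps(1) is_object_simps(1)]

section \<open>Propositional rules under a hypothesis\<close>

lemma derivable_Empty: "\<turnstile> \<^bold>\<emptyset>"
  using R1[OF imp_Empty imp_Empty, of "\<^bold>\<emptyset>"] by simp

text \<open>A10 joins two objects only when each is given as implied by \<open>Empty\<close>. A11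
  brings derivable implications into that form, hence the shape of both conjuncts. The premises of
  A1, A2 and A3 have this shape, so these axioms become rules.\<close>

lemma derivable_fedI:
  assumes "is_object A" "is_object B" "is_object C" "is_object D" "\<turnstile> A \<^bold>\<Rightarrow> B" "\<turnstile> C \<^bold>\<Rightarrow> D"
  shows "\<turnstile> (A \<^bold>\<Rightarrow> B) \<^bold>& (C \<^bold>\<Rightarrow> D)"
proof -
  have "\<turnstile> \<^bold>\<emptyset> \<^bold>\<Rightarrow> (A \<^bold>\<Rightarrow> B)" and *: "\<turnstile> \<^bold>\<emptyset> \<^bold>\<Rightarrow> (C \<^bold>\<Rightarrow> D)"
    using assms R1 A11_inst by blast+
  then show ?thesis
    by (intro R1[OF * R1[OF _ A10_inst]]) (simp_all add: assms)
qed

lemma mp_under: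
  assumes "is_object A" "is_object B" "is_object C" "\<turnstile> C \<^bold>\<Rightarrow> A" "\<turnstile> C \<^bold>\<Rightarrow> (A \<^bold>\<Rightarrow> B)"
  shows "\<turnstile> C \<^bold>\<Rightarrow> B"
  by (rule R1[OF derivable_fedI[OF _ _ _ _ assms(4,5)] A1_inst]) (simp_all add: assms)

lemma trans_under:
  assumes "is_object A" "is_object B" "is_object C" "is_object D"
    and "\<turnstile> D \<^bold>\<Rightarrow> (A \<^bold>\<Rightarrow> B)" "\<turnstile> D \<^bold>\<Rightarrow> (B \<^bold>\<Rightarrow> C)"
  shows "\<turnstile> D \<^bold>\<Rightarrow> (A \<^bold>\<Rightarrow> C)"
  by (rule R1[OF derivable_fedI[OF _ _ _ _ assms(5,6)] A2_inst]) (simp_all add: assms)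

lemma fedI_under:
  assumes "is_object A" "is_object B" "is_object C" "\<turnstile> C \<^bold>\<Rightarrow> A" "\<turnstile> C \<^bold>\<Rightarrow> B"
  shows "\<turnstile> C \<^bold>\<Rightarrow> (A \<^bold>& B)"
  by (rule R1[OF derivable_fedI[OF _ _ _ _ assms(4,5)] A3_inst]) (simp_all add: assms)

text \<open>This is A2 with \<open>d\<close> replaced by \<open>Empty\<close>, which is derivable
  and can be detached.\<close>

lemma imp_trans:
  assumes "is_object A" "is_object B" "is_object C" "\<turnstile> A \<^bold>\<Rightarrow> B" "\<turnstile> B \<^bold>\<Rightarrow> C"
  shows "\<turnstile> A \<^bold>\<Rightarrow> C"
proof -
  have "\<turnstile> \<^bold>\<emptyset> \<^bold>\<Rightarrow> (A \<^bold>\<Rightarrow> B)" "\<turnstile> \<^bold>\<emptyset> \<^bold>\<Rightarrow> (B \<^bold>\<Rightarrow> C)"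
    using assms R1 A11_inst by blast+
  then show ?thesis
    by (rule R1[OF derivable_Empty trans_under, rotated 4]) (simp_all add: assms)
qed

text \<open>The chain runs through \<open>Empty\<close>: A8 leads from \<open>C\<close> to it, and
  A11 leads from it to the derivable implication.\<close>

lemma weaken:
  assumes "is_object A" "is_object B" "is_object C" "\<turnstile> A \<^bold>\<Rightarrow> B"
  shows "\<turnstile> C \<^bold>\<Rightarrow> (A \<^bold>\<Rightarrow> B)"
  by (rule imp_trans[OF _ _ _ imp_Empty R1[OF assms(4) A11_inst]]) (simp_all add: assms)

lemma curry_imp:
  assumes [simp]: "is_object P" "is_object Q" "is_object H" "is_object C"
    and *: "\<turnstile> ((P \<^bold>\<Rightarrow> Q) \<^bold>& H) \<^bold>\<Rightarrow> C"
  shows "\<turnstile> (P \<^bold>\<Rightarrow> Q) \<^bold>\<Rightarrow> (H \<^bold>\<Rightarrow> C)"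
proof -
  let ?p = "P \<^bold>\<Rightarrow> Q"
  \<comment> \<open>Under \<open>?p\<close>, A8 gives \<open>H\<close> implies \<open>Empty\<close>,
    and A11 gives \<open>Empty\<close> implies \<open>?p\<close>. The latter is where
    \<open>?p\<close> must be an implication.\<close>
  have "\<turnstile> ?p \<^bold>\<Rightarrow> (H \<^bold>\<Rightarrow> ?p)"
    by (rule trans_under[OF _ _ _ _ weaken[OF _ _ _ imp_Empty] A11_inst]) simp_all
  moreover have "\<turnstile> ?p \<^bold>\<Rightarrow> (H \<^bold>\<Rightarrow> H)"
    by (rule weaken[OF _ _ _ imp_refl]) simp_all
  ultimately have "\<turnstile> ?p \<^bold>\<Rightarrow> ((H \<^bold>\<Rightarrow> ?p) \<^bold>& (H \<^bold>\<Rightarrow> H))"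
    by (intro fedI_under) simp_all
  then have "\<turnstile> ?p \<^bold>\<Rightarrow> (H \<^bold>\<Rightarrow> (?p \<^bold>& H))"
    by (rule imp_trans[OF _ _ _ _ A3_inst, rotated 3]) simp_all
  then show ?thesis
    by (rule trans_under[rotated 4]) (use * in \<open>simp_all add: weaken\<close>)
qed

section \<open>Membership in classes\<close>

lemma mem_cls:
  assumes [simp]: "is_object \<alpha>" "is_variable x" "is_variable b" "b \<noteq> x"
  shows "\<turnstile> mem b x \<lbrace>x \<^bold>| \<alpha>\<rbrace> \<^bold>= (Sing b x \<^bold>& \<alpha>)"
proof -
  \<comment> \<open>A13 wants the element to be a variable other than \<open>x\<close>, whereas here
    it is \<open>x\<close> itself. So A13 is taken for a fresh \<open>a\<close>, which R2 then
    replaces by \<open>x\<close>; the bound occurrences are indices and stay untouched.\<close>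
  obtain a where [simp]: "is_variable a" and a: "a \<notin> fvs \<alpha> \<union> {b, x}"
    using ex_fresh_variable[of "fvs \<alpha> \<union> {b, x}"] by auto
  have "distinct_variables [a, b, x]"
    using a by (auto simp: distinct_variables_def)
  then have "\<turnstile> mem b a \<lbrace>x \<^bold>| \<alpha>\<rbrace> \<^bold>= (Sing b a \<^bold>& subst \<alpha> x a)"
    by (rule A13) simp
  then have "\<turnstile> subst (mem b a \<lbrace>x \<^bold>| \<alpha>\<rbrace> \<^bold>= (Sing b a \<^bold>& subst \<alpha> x a)) a x"
    by (rule R2) simp_all
  then show ?thesis
    using a by (auto simp: equal_def subst_subst_back split: if_splits)
qed

lemma mem_clsD:
  assumes [simp]: "is_object \<alpha>" "is_variable x" "is_variable b" "b \<noteq> x" "is_object D"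
    and "\<turnstile> D \<^bold>\<Rightarrow> mem b x \<lbrace>x \<^bold>| \<alpha>\<rbrace>"
  shows "\<turnstile> D \<^bold>\<Rightarrow> Sing b x" "\<turnstile> D \<^bold>\<Rightarrow> \<alpha>"
proof -
  have "\<turnstile> mem b x \<lbrace>x \<^bold>| \<alpha>\<rbrace> \<^bold>\<Rightarrow> (Sing b x \<^bold>& \<alpha>)"
    by (rule R1[OF mem_cls[unfolded equal_def] fed_left]) simp_all
  then have *: "\<turnstile> D \<^bold>\<Rightarrow> (Sing b x \<^bold>& \<alpha>)"
    by (rule imp_trans[OF _ _ _ assms(6), rotated 3]) simp_all
  show "\<turnstile> D \<^bold>\<Rightarrow> Sing b x"
    by (rule imp_trans[OF _ _ _ * fed_left]) simp_all
  show "\<turnstile> D \<^bold>\<Rightarrow> \<alpha>"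
    by (rule imp_trans[OF _ _ _ * fed_right]) simp_all
qed

lemma mem_clsI:
  assumes [simp]: "is_object \<alpha>" "is_variable x" "is_variable b" "b \<noteq> x" "is_object D"
    and "\<turnstile> D \<^bold>\<Rightarrow> Sing b x" "\<turnstile> D \<^bold>\<Rightarrow> \<alpha>"
  shows "\<turnstile> D \<^bold>\<Rightarrow> mem b x \<lbrace>x \<^bold>| \<alpha>\<rbrace>"
proof -
  have "\<turnstile> (Sing b x \<^bold>& \<alpha>) \<^bold>\<Rightarrow> mem b x \<lbrace>x \<^bold>| \<alpha>\<rbrace>"
    by (rule R1[OF mem_cls[unfolded equal_def] fed_right]) simp_all
  then show ?thesis
    by (rule imp_trans[OF _ _ _ fedI_under[OF _ _ _ assms(6,7)], rotated 6]) simp_all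
qed

lemma cls_mem:
  assumes [simp]: "is_object u" "is_variable x" "is_variable b" "b \<noteq> x" "x \<notin> fvs u"
  shows "\<turnstile> u \<^bold>\<Rightarrow> \<lbrace>x \<^bold>| mem b x u\<rbrace>"
    and "\<turnstile> (\<^bold>V \<^bold>\<Rightarrow> u) \<^bold>\<Rightarrow> (\<lbrace>x \<^bold>| mem b x u\<rbrace> \<^bold>\<Rightarrow> u)"
proof -
  obtain a where a [simp]: "is_variable a" "a \<notin> {b, x}"
    using ex_fresh_variable[of "{b, x}"] by auto
  have dist: "distinct_variables [a, b, x]"
    using a by (auto simp: distinct_variables_def)
  \<comment> \<open>Substituting after closing agrees with closing after substituting, because
    \<open>x\<close> does not appear in \<open>u\<close> and so nothing in \<open>u\<close> gets
    bound.\<close>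
  have "subst \<lbrace>x \<^bold>| mem b x a\<rbrace> a u = \<lbrace>x \<^bold>| mem b x u\<rbrace>"
    using a by (auto simp: cls_def)
  then show "\<turnstile> u \<^bold>\<Rightarrow> \<lbrace>x \<^bold>| mem b x u\<rbrace>"
    and "\<turnstile> (\<^bold>V \<^bold>\<Rightarrow> u) \<^bold>\<Rightarrow> (\<lbrace>x \<^bold>| mem b x u\<rbrace> \<^bold>\<Rightarrow> u)"
    using R2[OF A14a[OF dist], of a u] R2[OF A14b[OF dist], of a u] by simp_all
qed

section \<open>Distribution of classes over implication\<close>

lemma univ_imp_cls:
  assumes [simp]: "is_object \<alpha>" "is_variable x"
  shows "\<turnstile> \<^bold>V \<^bold>\<Rightarrow> \<lbrace>x \<^bold>| \<alpha>\<rbrace>"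
proof -
  \<comment> \<open>R3 reverses the implication between the classes, and the class of
    \<open>Empty\<close> is \<open>univ\<close>.\<close>
  have "\<turnstile> \<^bold>\<emptyset> \<^bold>\<Rightarrow> (\<alpha> \<^bold>\<Rightarrow> \<^bold>\<emptyset>)"
    by (simp add: weaken imp_Empty)
  then have "\<turnstile> \<^bold>\<emptyset> \<^bold>\<Rightarrow> (\<lbrace>x \<^bold>| \<^bold>\<emptyset>\<rbrace> \<^bold>\<Rightarrow> \<lbrace>x \<^bold>| \<alpha>\<rbrace>)"
    by (rule R3) simp_all
  then show ?thesis
    using R1[OF derivable_Empty] by (simp add: univ_eq)
qed

lemma cls_imp_distrib:
  assumes [simp]: "is_object \<alpha>" "is_object \<beta>" "is_variable x"
  shows "\<turnstile> (\<lbrace>x \<^bold>| \<alpha> \<^bold>\<Rightarrow> \<beta>\<rbrace> \<^bold>\<Rightarrow> \<^bold>V) \<^bold>\<Rightarrow> (\<lbrace>x \<^bold>| \<beta>\<rbrace> \<^bold>\<Rightarrow> \<lbrace>x \<^bold>| \<alpha>\<rbrace>)"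
proof -
  \<comment> \<open>\<open>b\<close> is the auxiliary variable of \<open>Sing\<close>; it must
    differ from \<open>x\<close> for A13 and A14.\<close>
  obtain b where [simp]: "is_variable b" "b \<noteq> x"
    using ex_fresh_variable[of "{x}"] by auto
  let ?c = "\<lbrace>x \<^bold>| \<alpha> \<^bold>\<Rightarrow> \<beta>\<rbrace>"
  let ?p = "?c \<^bold>\<Rightarrow> \<^bold>V" and ?m = "\<lambda>t. mem b x \<lbrace>x \<^bold>| t\<rbrace>"
  let ?D = "?p \<^bold>& ?m \<alpha>"
  have Dp: "\<turnstile> ?D \<^bold>\<Rightarrow> ?p" and Dm: "\<turnstile> ?D \<^bold>\<Rightarrow> ?m \<alpha>"
    by (simp_all add: fed_left fed_right)
  have sing: "\<turnstile> ?D \<^bold>\<Rightarrow> Sing b x" and alpha: "\<turnstile> ?D \<^bold>\<Rightarrow> \<alpha>"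
    using mem_clsD[OF _ _ _ _ _ Dm] by simp_all
  have "\<turnstile> ?D \<^bold>\<Rightarrow> mem b x \<^bold>V"
    using mem_clsI[OF _ _ _ _ _ sing imp_Empty] by (simp add: univ_eq)
  then have "\<turnstile> ?D \<^bold>\<Rightarrow> (\<^bold>V \<^bold>\<Rightarrow> x)"
    unfolding mem_def[of b x "\<^bold>V"] by (rule imp_trans[OF _ _ _ _ fed_right, rotated 3]) simp_all
  \<comment> \<open>Membership contains the implication from the class to its element, so composing
    with \<open>?p\<close> carries \<open>x\<close> from \<open>univ\<close> into
    \<open>?c\<close>.\<close>
  then have "\<turnstile> ?D \<^bold>\<Rightarrow> (?c \<^bold>\<Rightarrow> x)"
    by (rule trans_under[OF _ _ _ _ Dp, rotated 4]) simp_all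
  then have "\<turnstile> ?D \<^bold>\<Rightarrow> mem b x ?c"
    unfolding mem_def[of b x ?c] by (intro fedI_under sing) simp_all
  then have "\<turnstile> ?D \<^bold>\<Rightarrow> (\<alpha> \<^bold>\<Rightarrow> \<beta>)"
    by (rule mem_clsD(2)[rotated 5]) simp_all
  then have "\<turnstile> ?D \<^bold>\<Rightarrow> \<beta>"
    by (rule mp_under[OF _ _ _ alpha, rotated 3]) simp_all
  then have "\<turnstile> ?D \<^bold>\<Rightarrow> ?m \<beta>"
    by (intro mem_clsI sing) simp_all
  then have "\<turnstile> ?p \<^bold>\<Rightarrow> (?m \<alpha> \<^bold>\<Rightarrow> ?m \<beta>)"
    by (intro curry_imp) simp_all
  \<comment> \<open>R3 applies since \<open>x\<close> is bound in \<open>?c\<close> and hence does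
    not appear in \<open>?p\<close>.\<close>
  then have *: "\<turnstile> ?p \<^bold>\<Rightarrow> (\<lbrace>x \<^bold>| ?m \<beta>\<rbrace> \<^bold>\<Rightarrow> \<lbrace>x \<^bold>| ?m \<alpha>\<rbrace>)"
    by (rule R3) simp_all
  \<comment> \<open>The premise of A14b holds for every class by
    \<open>univ_imp_cls\<close>.\<close>
  have "\<turnstile> \<lbrace>x \<^bold>| ?m \<alpha>\<rbrace> \<^bold>\<Rightarrow> \<lbrace>x \<^bold>| \<alpha>\<rbrace>"
    by (rule R1[OF univ_imp_cls cls_mem(2)]) simp_all
  then have "\<turnstile> ?p \<^bold>\<Rightarrow> (\<lbrace>x \<^bold>| ?m \<alpha>\<rbrace> \<^bold>\<Rightarrow> \<lbrace>x \<^bold>| \<alpha>\<rbrace>)"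
    by (intro weaken) simp_all
  then have "\<turnstile> ?p \<^bold>\<Rightarrow> (\<lbrace>x \<^bold>| ?m \<beta>\<rbrace> \<^bold>\<Rightarrow> \<lbrace>x \<^bold>| \<alpha>\<rbrace>)"
    by (rule trans_under[OF _ _ _ _ *, rotated 4]) simp_all
  \<comment> \<open>A14a supplies the remaining link, from the class of \<beta> to the class of its
    members.\<close>
  then show ?thesis
    by (rule trans_under[rotated 5]) (simp_all add: weaken cls_mem)
qed

theorem theorem3p18:
  fixes \<gamma> \<alpha> \<beta> x :: obj
  assumes "is_object \<gamma>" and "is_object \<alpha>" and "is_object \<beta>" and "is_variable x"
  shows "\<turnstile> (\<lbrace>x \<^bold>| \<gamma>\<rbrace> \<^bold>\<sqsubseteq> \<lbrace>x \<^bold>| \<alpha> \<^bold>\<Rightarrow> \<beta>\<rbrace>) \<^bold>\<Rightarrow>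
           ((\<^bold>V \<^bold>\<sqsubseteq> \<lbrace>x \<^bold>| \<gamma>\<rbrace>) \<^bold>\<Rightarrow> (\<lbrace>x \<^bold>| \<alpha>\<rbrace> \<^bold>\<sqsubseteq> \<lbrace>x \<^bold>| \<beta>\<rbrace>))"
proof -
  note [simp] = assms
  let ?c = "\<lbrace>x \<^bold>| \<alpha> \<^bold>\<Rightarrow> \<beta>\<rbrace>" and ?g = "\<lbrace>x \<^bold>| \<gamma>\<rbrace>"
  let ?D = "(?c \<^bold>\<Rightarrow> ?g) \<^bold>& (?g \<^bold>\<Rightarrow> \<^bold>V)"
  have "\<turnstile> ?D \<^bold>\<Rightarrow> (?c \<^bold>\<Rightarrow> \<^bold>V)"
    by (rule trans_under[OF _ _ _ _ fed_left fed_right]) simp_all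
  then have "\<turnstile> ?D \<^bold>\<Rightarrow> (\<lbrace>x \<^bold>| \<beta>\<rbrace> \<^bold>\<Rightarrow> \<lbrace>x \<^bold>| \<alpha>\<rbrace>)"
    by (rule imp_trans[OF _ _ _ _ cls_imp_distrib, rotated 3]) simp_all
  \<comment> \<open>The first hypothesis is an implication between classes, so
    \<open>curry_imp\<close> can split the federation \<open>?D\<close>.\<close>
  then show ?thesis
    unfolding below_def by (intro curry_imp) simp_all
qed

end
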